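(* Let $T$ be a hyponormal operator on a complex Hilbert space $\mathcal{H}$ and let $\lambda\in\mathbb{C}$. If $\lambda$ is not a limit point of the spectrum $\sigma(T)$, then the range of $T-\lambda I$ is closed.
   Context: An operator is a bounded linear transformation of a Hilbert space into itself. An operator $T$ is hyponormal if $T^*T-TT^*\ge 0$. *)

theory Defs
  imports "HOL-Analysis.Analysis"
begin

text \<open>
  Complex Hilbert spaces, as complex counterparts of the library's classes
  \<open>real_inner\<close> and \<open>complete_space\<close>.  Building on \<open>real_normed_vector\<close>
  gives access to the library's norm topology, completeness and bounded (real-)linear maps;
  \<open>scaleR_scaleC\<close> makes the real structure the restriction of the complex one.
\<close>

class complex_normed_vector = real_normed_vector +
  fixes scaleC :: "complex \<Rightarrow> 'a \<Rightarrow> 'a"  (infixr "*\<^sub>C" 75)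
  assumes scaleC_add_right: "a *\<^sub>C (x + y) = a *\<^sub>C x + a *\<^sub>C y"
    and scaleC_add_left: "(a + b) *\<^sub>C x = a *\<^sub>C x + b *\<^sub>C x"
    and scaleC_scaleC: "a *\<^sub>C (b *\<^sub>C x) = (a * b) *\<^sub>C x"
    and scaleC_one: "1 *\<^sub>C x = x"
    and scaleR_scaleC: "r *\<^sub>R x = complex_of_real r *\<^sub>C x"
    and norm_scaleC: "norm (a *\<^sub>C x) = cmod a * norm x"

text \<open>The inner product is linear in its first and conjugate-linear in its second argument.\<close>

class complex_inner = complex_normed_vector +
  fixes cinner :: "'a \<Rightarrow> 'a \<Rightarrow> complex"
  assumes cinner_commute: "cinner x y = cnj (cinner y x)"
    and cinner_add_left: "cinner (x + y) z = cinner x z + cinner y z"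
    and cinner_scaleC_left: "cinner (a *\<^sub>C x) y = a * cinner x y"
    and cinner_nonneg: "cinner x x \<in> \<real>\<^sub>\<ge>\<^sub>0"
    and cinner_eq_zero_iff: "cinner x x = 0 \<longleftrightarrow> x = 0"
    and norm_eq_sqrt_cinner: "norm x = sqrt (Re (cinner x x))"

class chilbert_space = complex_inner + complete_space

instantiation complex :: chilbert_space
begin

definition scaleC_complex :: "complex \<Rightarrow> complex \<Rightarrow> complex"
  where "scaleC_complex a x = a * x"

definition cinner_complex :: "complex \<Rightarrow> complex \<Rightarrow> complex"
  where "cinner_complex x y = x * cnj y"

instance
proof
  fix x :: complex
  show "cinner x x \<in> \<real>\<^sub>\<ge>\<^sub>0"
    by (auto simp: cinner_complex_def complex_nonneg_Reals_iff)
  show "norm x = sqrt (Re (cinner x x))"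
    by (simp add: cinner_complex_def cmod_def power2_eq_square)
qed (auto simp: scaleC_complex_def cinner_complex_def algebra_simps norm_mult scaleR_conv_of_real)

end

definition bounded_clinear :: "('a::complex_normed_vector \<Rightarrow> 'b::complex_normed_vector) \<Rightarrow> bool"
  where "bounded_clinear T \<longleftrightarrow> bounded_linear T \<and> (\<forall>a x. T (a *\<^sub>C x) = a *\<^sub>C T x)"

text \<open>
  The Hilbert space adjoint \<open>T\<^sup>*\<close>.  The description is meaningful for bounded operators on a
  Hilbert space: existence is the Riesz representation theorem, uniqueness is
  \<open>cadjoint_eqI\<close> below.
\<close>

definition cadjoint :: "('a::complex_inner \<Rightarrow> 'a) \<Rightarrow> 'a \<Rightarrow> 'a"
  where "cadjoint T = (THE S. \<forall>x y. cinner (T x) y = cinner x (S y))"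

lemma cadjoint_eqI:
  fixes T S :: "'a::complex_inner \<Rightarrow> 'a"
  assumes S: "\<And>x y. cinner (T x) y = cinner x (S y)"
  shows "cadjoint T = S"
  unfolding cadjoint_def
proof (rule the_equality)
  show "\<forall>x y. cinner (T x) y = cinner x (S y)"
    using S by blast
  fix R assume R: "\<forall>x y. cinner (T x) y = cinner x (R y)"
  have left: "cinner (R y) z = cinner (S y) z" for y z
    by (metis R S cinner_commute)
  show "R = S"
  proof
    fix y
    have "cinner (R y - S y) z + cinner (S y) z = cinner (R y) z" for z
      by (metis cinner_add_left diff_add_cancel)
    then have "cinner (R y - S y) (R y - S y) = 0"
      using left by (metis add_cancel_left_left)
    then show "R y = S y"
      by (simp add: cinner_eq_zero_iff)
  qed
qed

definition positive_operator :: "('a::complex_inner \<Rightarrow> 'a) \<Rightarrow> bool"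
  where "positive_operator A \<longleftrightarrow> bounded_clinear A \<and> (\<forall>x. cinner (A x) x \<in> \<real>\<^sub>\<ge>\<^sub>0)"

definition hyponormal :: "('a::complex_inner \<Rightarrow> 'a) \<Rightarrow> bool"
  where "hyponormal T \<longleftrightarrow> bounded_clinear T \<and>
    positive_operator (\<lambda>x. cadjoint T (T x) - T (cadjoint T x))"

definition invertible_operator :: "('a::complex_normed_vector \<Rightarrow> 'a) \<Rightarrow> bool"
  where "invertible_operator A \<longleftrightarrow> (\<exists>B. bounded_clinear B \<and> A \<circ> B = id \<and> B \<circ> A = id)"

definition spectrum :: "('a::complex_normed_vector \<Rightarrow> 'a) \<Rightarrow> complex set"
  where "spectrum T = {\<mu>. \<not> invertible_operator (\<lambda>x. T x - \<mu> *\<^sub>C x)}"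

end

theory Submission
  imports Defs "HOL-Complex_Analysis.Complex_Analysis"
begin

text \<open>
  Put \<open>S = T - \<mu>\<close>.  Since \<open>\<mu>\<close> is not a limit point of the spectrum, the resolvent
  \<open>R w = (S - w)\<^sup>-\<^sup>1\<close> exists on a punctured disc about 0.  Let \<open>B\<close> and \<open>Q\<close> be the averages of
  \<open>R w\<close> and of \<open>w R w\<close> over a small circle \<open>cmod w = \<epsilon>\<close>.  Averaging \<open>S R w = R w S = 1 + w R w\<close>
  gives \<open>S B = 1 + Q\<close> and \<open>S Q = Q S\<close>.  If moreover \<open>S Q = 0\<close>, then \<open>S B S = S + Q S = S\<close>; hence
  \<open>y\<close> lies in the range of \<open>S\<close> exactly when \<open>S (B y) = y\<close>, and this is a closed condition
  (\<open>closed_range_S\<close>).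

  Everything thus rests on \<open>S Q = 0\<close>, which uses hyponormality.  By Cauchy's theorem \<open>Q\<close> does not
  depend on \<open>\<epsilon>\<close> (\<open>moment_1_radius_independent\<close>), while \<open>S ^^ n\<close> applied to \<open>Q x\<close> is the average of
  \<open>w ^ (n + 1) R w x\<close> (\<open>S_moment\<close>).  As \<open>\<epsilon>\<close> can be taken arbitrarily small, the orbit of \<open>Q x\<close>
  under \<open>S\<close> decays faster than any geometric sequence.  On the other hand a translate of a
  hyponormal operator satisfies \<open>(norm (S u))\<^sup>2 \<le> norm (S (S u)) * norm u\<close>
  (\<open>hyponormal_translate_paranormal\<close>), so the ratios of consecutive terms
  \<open>norm ((S ^^ n) v)\<close> never decrease, and an orbit can only decay that fast if \<open>S v = 0\<close>
  (\<open>paranormal_orbit_eq_0\<close>).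

  Hyponormality only becomes usable once the adjoint is known to exist, which is the Riesz
  representation theorem.
\<close>

section \<open>Complex inner product spaces\<close>

instance chilbert_space \<subseteq> banach ..

lemma norm_power2_eq_cinner: "(norm x)\<^sup>2 = Re (cinner x (x::'a::complex_inner))"
proof -
  have "Re (cinner x x) \<ge> 0"
    using cinner_nonneg[of x] by (auto simp: complex_nonneg_Reals_iff)
  then show ?thesis
    by (simp add: norm_eq_sqrt_cinner)
qed

lemma cinner_add_right: "cinner x (y + z) = cinner x y + cinner x (z::'a::complex_inner)"
  by (metis cinner_add_left cinner_commute complex_cnj_add)

lemma cinner_scaleC_right: "cinner x (a *\<^sub>C y) = cnj a * cinner x (y::'a::complex_inner)"
  by (metis cinner_commute cinner_scaleC_left complex_cnj_mult)

lemma scaleC_minus1: "(-1) *\<^sub>C x = - (x::'a::complex_normed_vector)"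
  by (metis of_real_1 of_real_minus scaleR_minus1_left scaleR_scaleC)

lemma cinner_minus_left: "cinner (- x) y = - cinner x (y::'a::complex_inner)"
  using cinner_scaleC_left[of "-1" x y] by (simp add: scaleC_minus1)

lemma cinner_minus_right: "cinner x (- y) = - cinner x (y::'a::complex_inner)"
  using cinner_scaleC_right[of x "-1" y] by (simp add: scaleC_minus1)

lemma cinner_diff_left: "cinner (x - y) z = cinner x z - cinner y (z::'a::complex_inner)"
  using cinner_add_left[of x "- y" z] by (simp add: cinner_minus_left)

lemma cinner_diff_right: "cinner x (y - z) = cinner x y - cinner x (z::'a::complex_inner)"
  using cinner_add_right[of x y "- z"] by (simp add: cinner_minus_right)

lemma cinner_scaleR_left: "cinner (r *\<^sub>R x) y = of_real r * cinner x (y::'a::complex_inner)"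
  by (simp add: scaleR_scaleC cinner_scaleC_left)

lemma cinner_scaleR_right: "cinner x (r *\<^sub>R y) = of_real r * cinner x (y::'a::complex_inner)"
  by (simp add: scaleR_scaleC cinner_scaleC_right)

lemma Re_cinner_commute: "Re (cinner x y) = Re (cinner y (x::'a::complex_inner))"
  by (metis cinner_commute cnj.sel(1))

lemmas cinner_simps =
  cinner_add_left cinner_add_right cinner_diff_left cinner_diff_right
  cinner_scaleR_left cinner_scaleR_right

lemma norm_add_power2:
  "(norm (x + y))\<^sup>2 = (norm x)\<^sup>2 + 2 * Re (cinner x y) + (norm (y::'a::complex_inner))\<^sup>2"
  using Re_cinner_commute[of x y] by (simp add: norm_power2_eq_cinner cinner_simps)

text \<open>
  Since the norm is already known to satisfy the triangle inequality, squaring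
  \<open>norm (x + y) \<le> norm x + norm y\<close> gives the Cauchy-Schwarz inequality.
\<close>

lemma Re_cinner_le: "Re (cinner x y) \<le> norm x * norm (y::'a::complex_inner)"
proof -
  have "(norm (x + y))\<^sup>2 \<le> (norm x + norm y)\<^sup>2"
    by (simp add: norm_triangle_ineq power_mono)
  then show ?thesis
    by (simp add: norm_add_power2 power2_sum)
qed

lemma cmod_cinner_le: "cmod (cinner x y) \<le> norm x * norm (y::'a::complex_inner)"
proof (cases "cinner x y = 0")
  case False
  \<comment> \<open>a unimodular factor turns \<open>cinner x y\<close> into its modulus\<close>
  define a where "a = cnj (cinner x y) / cmod (cinner x y)"
  have "a * cinner x y = cmod (cinner x y)"
    using False by (simp add: a_def complex_norm_square[symmetric] power2_eq_square mult.commute)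
  then have "cmod (cinner x y) = Re (cinner (a *\<^sub>C x) y)"
    by (simp add: cinner_scaleC_left)
  also have "\<dots> \<le> norm (a *\<^sub>C x) * norm y"
    by (rule Re_cinner_le)
  also have "\<dots> = norm x * norm y"
    using False by (simp add: norm_scaleC a_def norm_divide)
  finally show ?thesis .
qed simp

lemma bounded_linear_cinner_left: "bounded_linear (\<lambda>x. cinner x (y::'a::complex_inner))"
  by (rule bounded_linear_intro[of _ "norm y"])
    (auto simp: cinner_simps cmod_cinner_le scaleR_conv_of_real)

lemma scaleC_bounded_bilinear: "bounded_bilinear (\<lambda>a (x::'a::complex_normed_vector). a *\<^sub>C x)"
proof
  show "\<exists>K. \<forall>a (b::'a). norm (a *\<^sub>C b) \<le> norm a * norm b * K"
    by (rule exI[of _ 1]) (simp add: norm_scaleC)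
qed (simp_all add: scaleC_add_left scaleC_add_right scaleR_scaleC[where ?'a = 'a] scaleC_scaleC
    scaleR_conv_of_real mult.commute)

lemmas bounded_linear_scaleC_left = bounded_bilinear.bounded_linear_left[OF scaleC_bounded_bilinear]
lemmas bounded_linear_scaleC_right = bounded_bilinear.bounded_linear_right[OF scaleC_bounded_bilinear]
lemmas continuous_on_scaleC = bounded_bilinear.continuous_on[OF scaleC_bounded_bilinear]
lemmas scaleC_diff_left = bounded_bilinear.diff_left[OF scaleC_bounded_bilinear]
lemmas scaleC_diff_right = bounded_bilinear.diff_right[OF scaleC_bounded_bilinear]
lemmas scaleC_zero_left = bounded_bilinear.zero_left[OF scaleC_bounded_bilinear]

section \<open>Riesz representation and the adjoint\<close>

text \<open>
  The representing vector is the minimiser of \<open>F x = (norm x)\<^sup>2 - 2 Re (\<phi> x)\<close>.  By the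
  parallelogram law, points where \<open>F\<close> is close to its infimum are close to each other, so
  completeness yields a minimiser; there the first variation of \<open>F\<close> vanishes.
\<close>

lemma riesz_representation:
  fixes \<phi> :: "'a::chilbert_space \<Rightarrow> complex"
  assumes lin: "bounded_linear \<phi>" and clin: "\<And>a x. \<phi> (a *\<^sub>C x) = a * \<phi> x"
  shows "\<exists>v. \<forall>x. \<phi> x = cinner x v"
proof -
  interpret \<phi>: bounded_linear \<phi> by (rule lin)
  define F where "F x = (norm x)\<^sup>2 - 2 * Re (\<phi> x)" for x
  obtain K where K: "\<And>x. norm (\<phi> x) \<le> norm x * K"
    using \<phi>.bounded by blast
  have F_lower: "- K\<^sup>2 \<le> F x" for x
  proof -
    have "Re (\<phi> x) \<le> norm x * K"
      using K[of x] complex_Re_le_cmod[of "\<phi> x"] by linarith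
    moreover have "0 \<le> (norm x - K)\<^sup>2" by simp
    ultimately show ?thesis
      by (simp add: F_def power2_diff)
  qed
  define m where "m = Inf (range F)"
  have bdd: "bdd_below (range F)"
    using F_lower by (rule bdd_belowI2)
  have m_le: "m \<le> F x" for x
    unfolding m_def by (rule cInf_lower[OF _ bdd]) simp
  have parallelogram: "(norm (x - y))\<^sup>2 \<le> 2 * (F x - m) + 2 * (F y - m)" for x y
  proof -
    define h where "h = (1/2) *\<^sub>R (x + y)"
    have "(norm (x - y))\<^sup>2 + 4 * F h = 2 * F x + 2 * F y"
      using Re_cinner_commute[of x y]
      by (simp add: F_def h_def norm_power2_eq_cinner cinner_simps \<phi>.add \<phi>.scaleR field_simps)
    then show ?thesis
      using m_le[of h] by argo
  qed
  have "\<exists>x. F x < m + inverse (Suc n)" for n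
    using cInf_lessD[of "range F" "m + inverse (Suc n)"] by (auto simp: m_def)
  then obtain s where s: "\<And>n. F (s n) < m + inverse (Suc n)"
    by metis
  have "Cauchy s"
  proof (rule metric_CauchyI)
    fix e :: real assume "e > 0"
    then have "0 < e\<^sup>2 / 4" by simp
    then obtain N where N: "inverse (real (Suc N)) < e\<^sup>2 / 4"
      using reals_Archimedean by blast
    have small: "F (s n) - m < e\<^sup>2 / 4" if "n \<ge> N" for n
    proof -
      have "inverse (real (Suc n)) \<le> inverse (real (Suc N))"
        using that by (intro le_imp_inverse_le) auto
      then show ?thesis using s[of n] N by linarith
    qed
    show "\<exists>M. \<forall>i\<ge>M. \<forall>j\<ge>M. dist (s i) (s j) < e"
    proof (intro exI allI impI)
      fix i j assume "i \<ge> N" "j \<ge> N"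
      then have "(norm (s i - s j))\<^sup>2 < e\<^sup>2"
        using small[of i] small[of j] parallelogram[of "s i" "s j"] by argo
      then show "dist (s i) (s j) < e"
        using \<open>e > 0\<close> by (simp add: dist_norm power_less_imp_less_base)
    qed
  qed
  then obtain v where v: "s \<longlonglongrightarrow> v"
    by (auto simp: Cauchy_convergent_iff convergent_def)
  have "(\<lambda>n. F (s n)) \<longlonglongrightarrow> F v"
    unfolding F_def by (intro tendsto_intros v \<phi>.tendsto)
  moreover have "(\<lambda>n. m + inverse (real (Suc n))) \<longlonglongrightarrow> m + 0"
    by (intro tendsto_intros LIMSEQ_inverse_real_of_nat)
  ultimately have "F v \<le> m + 0"
    by (rule LIMSEQ_le) (use s less_imp_le in blast)
  then have F_min: "F v \<le> F x" for x
    using m_le[of x] by simp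
  have Re_eq: "Re (\<phi> x) = Re (cinner x v)" for x
  proof -
    define d where "d = Re (cinner x v) - Re (\<phi> x)"
    have variation: "0 \<le> 2 * t * d + t\<^sup>2 * (norm x)\<^sup>2" for t :: real
    proof -
      have "F (v + t *\<^sub>R x) = F v + 2 * t * d + t\<^sup>2 * (norm x)\<^sup>2"
        using Re_cinner_commute[of x v]
        by (simp add: F_def d_def norm_add_power2 cinner_simps \<phi>.add \<phi>.scaleR power_mult_distrib
            algebra_simps)
      then show ?thesis using F_min[of "v + t *\<^sub>R x"] by simp
    qed
    have "d = 0"
    proof (rule ccontr)
      assume "d \<noteq> 0"
      \<comment> \<open>at this \<open>t\<close> the linear term dominates the quadratic one\<close>
      define t where "t = - d / ((norm x)\<^sup>2 + 1)"
      have pos: "(norm x)\<^sup>2 + 1 > 0" by (simp add: add_nonneg_pos)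
      then have d: "d = - t * ((norm x)\<^sup>2 + 1)" by (simp add: t_def field_simps)
      have "t \<noteq> 0" using \<open>d \<noteq> 0\<close> d by auto
      have "2 * t * d + t\<^sup>2 * (norm x)\<^sup>2 = - t\<^sup>2 * ((norm x)\<^sup>2 + 2)"
        by (subst d) (simp add: algebra_simps power2_eq_square)
      also have "\<dots> < 0"
        using \<open>t \<noteq> 0\<close> by (simp add: mult_pos_pos add_nonneg_pos)
      finally show False using variation[of t] by simp
    qed
    then show ?thesis by (simp add: d_def)
  qed
  have "\<phi> x = cinner x v" for x
  proof (rule complex_eqI)
    show "Im (\<phi> x) = Im (cinner x v)"
      using Re_eq[of "\<i> *\<^sub>C x"] by (simp add: clin cinner_scaleC_left)
  qed (rule Re_eq)
  then show ?thesis by blast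
qed

lemma bounded_clinearD:
  assumes "bounded_clinear A"
  shows "bounded_linear A" "A (a *\<^sub>C x) = a *\<^sub>C A x"
  using assms by (auto simp: bounded_clinear_def)

lemma cinner_cadjoint:
  fixes A :: "'a::chilbert_space \<Rightarrow> 'a"
  assumes A: "bounded_clinear A"
  shows "cinner (A x) y = cinner x (cadjoint A y)"
proof -
  have "\<exists>v. \<forall>x. cinner (A x) y = cinner x v" for y
    using bounded_linear_compose[OF bounded_linear_cinner_left bounded_clinearD(1)[OF A]]
    by (rule riesz_representation) (simp add: bounded_clinearD(2)[OF A] cinner_scaleC_left)
  then obtain S where S: "\<And>x y. cinner (A x) y = cinner x (S y)"
    by metis
  show ?thesis
    using S cadjoint_eqI[of A S, OF S] by simp
qed

section \<open>Translates of hyponormal operators\<close>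

text \<open>
  Pairing \<open>T\<^sup>*T - TT\<^sup>*\<close> with \<open>x\<close> turns hyponormality into \<open>norm (T\<^sup>* x) \<le> norm (T x)\<close>.  This
  passes to \<open>S = T - \<mu>\<close>, because the cross terms in \<open>(norm (S x))\<^sup>2\<close> and \<open>(norm (S\<^sup>* x))\<^sup>2\<close> are
  complex conjugates.  Then
  \<open>(norm (S u))\<^sup>2 = Re (cinner u (S\<^sup>* (S u))) \<le> norm u * norm (S (S u))\<close>.
\<close>

lemma hyponormal_translate_paranormal:
  fixes T :: "'a::chilbert_space \<Rightarrow> 'a" and \<mu> :: complex
  assumes "hyponormal T"
  defines "S \<equiv> \<lambda>x. T x - \<mu> *\<^sub>C x"
  shows "(norm (S u))\<^sup>2 \<le> norm (S (S u)) * norm u"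
proof -
  have clin: "bounded_clinear T"
    and pos: "cinner (cadjoint T (T x) - T (cadjoint T x)) x \<in> \<real>\<^sub>\<ge>\<^sub>0" for x
    using assms(1) by (auto simp: hyponormal_def positive_operator_def)
  note adj = cinner_cadjoint[OF clin]
  define S' where "S' x = cadjoint T x - cnj \<mu> *\<^sub>C x" for x
  have S': "cinner (S x) y = cinner x (S' y)" for x y
    by (simp add: S_def S'_def cinner_simps cinner_scaleC_left cinner_scaleC_right adj)
  have T_le: "Re (cinner (cadjoint T x) (cadjoint T x)) \<le> Re (cinner (T x) (T x))" for x
  proof -
    have "Re (cinner (T (cadjoint T x)) x) \<le> Re (cinner (cadjoint T (T x)) x)"
      using pos[of x] by (simp add: cinner_simps complex_nonneg_Reals_iff)
    then show ?thesis
      by (simp add: adj Re_cinner_commute[of "cadjoint T (T x)" x])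
  qed
  have S'_le: "norm (S' x) \<le> norm (S x)" for x
  proof -
    have cross: "cinner (T x) x = cnj (cinner (cadjoint T x) x)"
      "cinner x (T x) = cinner (cadjoint T x) x"
      "cinner x (cadjoint T x) = cnj (cinner (cadjoint T x) x)"
      using adj[of x x] cinner_commute[of x "T x"] cinner_commute[of x "cadjoint T x"] by simp_all
    have "(norm (S' x))\<^sup>2 \<le> (norm (S x))\<^sup>2"
      unfolding norm_power2_eq_cinner S_def S'_def
      using T_le[of x]
      by (simp add: cinner_simps cinner_scaleC_left cinner_scaleC_right cross algebra_simps)
    then show ?thesis by (rule power2_le_imp_le) simp
  qed
  have "(norm (S u))\<^sup>2 = Re (cinner u (S' (S u)))"
    by (simp add: norm_power2_eq_cinner S')
  also have "\<dots> \<le> norm u * norm (S' (S u))"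
    by (rule Re_cinner_le)
  also have "\<dots> \<le> norm u * norm (S (S u))"
    by (simp add: S'_le mult_left_mono)
  finally show ?thesis by (simp add: mult.commute)
qed

text \<open>
  The inequality makes \<open>norm ((S ^^ n) v)\<close> logarithmically convex in \<open>n\<close>, so the
  ratio of the first two terms bounds all later ratios from below: unless \<open>S v = 0\<close>, the orbit
  cannot decay faster than geometrically.
\<close>

lemma paranormal_orbit_eq_0:
  fixes S :: "'a::real_normed_vector \<Rightarrow> 'a"
  assumes para: "\<And>u. (norm (S u))\<^sup>2 \<le> norm (S (S u)) * norm u"
    and zero: "S 0 = 0" and "r > 0"
    and decay: "\<And>\<epsilon>. 0 < \<epsilon> \<Longrightarrow> \<epsilon> < r \<Longrightarrow> \<exists>K. \<forall>n. norm ((S ^^ n) v) \<le> K * \<epsilon> ^ n"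
  shows "S v = 0"
proof (rule ccontr)
  assume "S v \<noteq> 0"
  then have "v \<noteq> 0" using zero by auto
  define q where "q = norm (S v) / norm v"
  have "q > 0" using \<open>S v \<noteq> 0\<close> \<open>v \<noteq> 0\<close> by (simp add: q_def)
  have step: "(S ^^ n) v \<noteq> 0 \<and> q * norm ((S ^^ n) v) \<le> norm ((S ^^ Suc n) v)" for n
  proof (induction n)
    case 0
    then show ?case using \<open>v \<noteq> 0\<close> by (simp add: q_def)
  next
    case (Suc n)
    let ?a = "norm ((S ^^ n) v)" and ?b = "norm ((S ^^ Suc n) v)"
    have "?a > 0" using Suc by simp
    then have "?b > 0" using Suc \<open>q > 0\<close> by (meson less_le_trans mult_pos_pos)
    have "(q * ?b) * ?a = (q * ?a) * ?b" by simp
    also have "\<dots> \<le> ?b * ?b"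
      using Suc by (intro mult_right_mono) auto
    also have "\<dots> \<le> norm ((S ^^ Suc (Suc n)) v) * ?a"
      using para[of "(S ^^ n) v"] by (simp add: power2_eq_square)
    finally have "q * ?b \<le> norm ((S ^^ Suc (Suc n)) v)"
      using \<open>?a > 0\<close> mult_right_le_imp_le by blast
    then show ?case using \<open>?b > 0\<close> by auto
  qed
  have growth: "q ^ n * norm v \<le> norm ((S ^^ n) v)" for n
  proof (induction n)
    case (Suc n)
    have "q ^ Suc n * norm v = q * (q ^ n * norm v)" by simp
    also have "\<dots> \<le> q * norm ((S ^^ n) v)"
      using Suc \<open>q > 0\<close> by (intro mult_left_mono) auto
    finally show ?case using step[of n] by linarith
  qed simp
  define \<epsilon> where "\<epsilon> = min (q / 2) (r / 2)"
  have \<epsilon>: "0 < \<epsilon>" "\<epsilon> < r" "\<epsilon> \<le> q / 2" using \<open>q > 0\<close> \<open>r > 0\<close> by (auto simp: \<epsilon>_def)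
  obtain K where K: "\<And>n. norm ((S ^^ n) v) \<le> K * \<epsilon> ^ n"
    using decay[OF \<epsilon>(1,2)] by blast
  have "K \<ge> 0" using order_trans[OF norm_ge_zero K[of 0]] by simp
  have bounded: "2 ^ n * norm v \<le> K" for n
  proof -
    have "q ^ n * norm v \<le> K * \<epsilon> ^ n" using growth K order_trans by blast
    also have "\<dots> \<le> K * (q / 2) ^ n"
      using \<epsilon> \<open>K \<ge> 0\<close> by (intro mult_left_mono power_mono) auto
    finally have "q ^ n * (2 ^ n * norm v) \<le> q ^ n * K"
      by (simp add: power_divide field_simps)
    then show ?thesis using \<open>q > 0\<close> by simp
  qed
  obtain n where "K / norm v < 2 ^ n"
    using real_arch_pow[of 2 "K / norm v"] by auto
  then show False
    using bounded[of n] \<open>v \<noteq> 0\<close> by (simp add: field_simps)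
qed

section \<open>Integrals over circles\<close>

lemma norm_circlepath_0: "r \<ge> 0 \<Longrightarrow> cmod (circlepath 0 r t) = r"
  by (simp add: circlepath norm_mult)

lemma continuous_on_circlepath: "continuous_on A (circlepath z r)"
  unfolding circlepath by (intro continuous_intros)

lemma contour_integral_circlepath_0:
  "contour_integral (circlepath 0 r) f
    = 2 * of_real pi * \<i> * integral {0..1} (\<lambda>t. circlepath 0 r t * f (circlepath 0 r t))"
  unfolding contour_integral_integral integral_mult_right[symmetric]
  by (rule integral_cong, unfold vector_derivative_circlepath) (simp add: circlepath mult_ac)

lemma integral_circlepath_0_power:
  assumes "r > 0" "n > 0"
  shows "integral {0..1} (\<lambda>t. circlepath 0 r t ^ n) = 0"
proof -
  have "contour_integral (circlepath 0 r) (\<lambda>z. z ^ (n - 1)) = 0"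
    by (rule contour_integral_unique, rule Cauchy_theorem_disc_simple[of _ 0 "r + 1"])
      (use assms in \<open>auto intro!: holomorphic_intros simp: path_image_circlepath\<close>)
  then show ?thesis
    using assms by (simp add: contour_integral_circlepath_0 power_eq_if)
qed

section \<open>A resolvent with an isolated singularity\<close>

text \<open>
  The last two assumptions say \<open>R w = (S - w)\<^sup>-\<^sup>1\<close>, in the form in which they are integrated.
  Values of \<open>R\<close> are bounded real-linear maps, because these form a normed space in which
  continuity of \<open>R\<close> and its integrals make sense; complex homogeneity is therefore assumed
  separately.
\<close>

locale punctured_resolvent =
  fixes S :: "'a::chilbert_space \<Rightarrow> 'a" and R :: "complex \<Rightarrow> 'a \<Rightarrow>\<^sub>L 'a" and r :: real
  assumes S: "bounded_clinear S" and r_pos: "r > 0"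
    and R_scaleC: "\<And>w a x. w \<noteq> 0 \<Longrightarrow> cmod w < r \<Longrightarrow> R w (a *\<^sub>C x) = a *\<^sub>C R w x"
    and S_R: "\<And>w x. w \<noteq> 0 \<Longrightarrow> cmod w < r \<Longrightarrow> S (R w x) = x + w *\<^sub>C R w x"
    and R_S: "\<And>w x. w \<noteq> 0 \<Longrightarrow> cmod w < r \<Longrightarrow> R w (S x) = x + w *\<^sub>C R w x"
begin

lemmas S_scaleC = bounded_clinearD(2)[OF S]

sublocale S: bounded_linear S
  by (rule bounded_clinearD(1)[OF S])

text \<open>Evaluate \<open>R w S R v x\<close> in two ways, by \<open>R_S\<close> and by \<open>S_R\<close>.\<close>

lemma resolvent_identity:
  assumes "w \<noteq> 0" "cmod w < r" "v \<noteq> 0" "cmod v < r"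
  shows "R w x - R v x = (w - v) *\<^sub>C R w (R v x)"
proof -
  have "R v x + w *\<^sub>C R w (R v x) = R w (S (R v x))"
    using assms by (simp add: R_S)
  also have "\<dots> = R w x + v *\<^sub>C R w (R v x)"
    using assms by (simp add: S_R R_scaleC blinfun.add_right)
  finally show ?thesis
    by (simp add: scaleC_diff_left algebra_simps)
qed

lemma norm_resolvent_diff_le:
  assumes "w \<noteq> 0" "cmod w < r" "v \<noteq> 0" "cmod v < r"
  shows "norm (R w - R v) \<le> cmod (w - v) * norm (R w) * norm (R v)"
proof (rule norm_blinfun_bound)
  fix x
  have "norm ((R w - R v) x) = cmod (w - v) * norm (R w (R v x))"
    using resolvent_identity[OF assms] by (simp add: blinfun.diff_left norm_scaleC)
  also have "\<dots> \<le> cmod (w - v) * (norm (R w) * (norm (R v) * norm x))"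
    by (intro mult_left_mono order_trans[OF norm_blinfun] norm_blinfun) auto
  finally show "norm ((R w - R v) x) \<le> cmod (w - v) * norm (R w) * norm (R v) * norm x"
    by (simp add: mult_ac)
qed simp

text \<open>
  Near \<open>v\<close> the bound on \<open>R w - R v\<close> has \<open>norm (R w)\<close> on its right-hand side; once
  \<open>cmod (w - v) * norm (R v)\<close> is below one half, this term can be absorbed, giving
  \<open>norm (R w) \<le> 2 * norm (R v)\<close> and hence a Lipschitz estimate.
\<close>

lemma continuous_on_resolvent: "continuous_on (ball 0 r - {0}) R"
proof -
  have "(R \<longlongrightarrow> R v) (at v within ball 0 r - {0})" if v: "v \<noteq> 0" "cmod v < r" for v
  proof (rule Lim_null_comparison[THEN LIM_zero_cancel])
    have "((\<lambda>w. cmod (w - v) * norm (R v)) \<longlongrightarrow> cmod (v - v) * norm (R v))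
        (at v within ball 0 r - {0})"
      by (intro tendsto_intros)
    then have "\<forall>\<^sub>F w in at v within ball 0 r - {0}. cmod (w - v) * norm (R v) < 1 / 2"
      by (rule order_tendstoD) simp
    moreover have "\<forall>\<^sub>F w in at v within ball 0 r - {0}. w \<in> ball 0 r - {0}"
      by (simp add: eventually_at_filter)
    ultimately show "\<forall>\<^sub>F w in at v within ball 0 r - {0}.
        norm (R w - R v) \<le> cmod (w - v) * (2 * norm (R v) * norm (R v))"
    proof eventually_elim
      case (elim w)
      have le: "norm (R w - R v) \<le> cmod (w - v) * norm (R w) * norm (R v)"
        using elim v by (intro norm_resolvent_diff_le) auto
      have "norm (R w) \<le> norm (R v) + norm (R w - R v)"
        by (metis add.commute diff_add_cancel norm_triangle_ineq)
      also have "norm (R w - R v) \<le> (cmod (w - v) * norm (R v)) * norm (R w)"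
        using le by (simp add: mult_ac)
      also have "\<dots> \<le> (1 / 2) * norm (R w)"
        using elim by (intro mult_right_mono) auto
      finally have "norm (R w) \<le> 2 * norm (R v)" by simp
      then have "cmod (w - v) * (norm (R w) * norm (R v))
          \<le> cmod (w - v) * (2 * norm (R v) * norm (R v))"
        by (intro mult_left_mono mult_right_mono) auto
      then show ?case using le by (simp add: mult_ac)
    qed
    have "((\<lambda>w. cmod (w - v) * (2 * norm (R v) * norm (R v)))
        \<longlongrightarrow> cmod (v - v) * (2 * norm (R v) * norm (R v))) (at v within ball 0 r - {0})"
      by (intro tendsto_intros)
    then show "((\<lambda>w. cmod (w - v) * (2 * norm (R v) * norm (R v))) \<longlongrightarrow> 0)
        (at v within ball 0 r - {0})" by simp
  qed
  then show ?thesis by (auto simp: continuous_on_def)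
qed

text \<open>By the resolvent identity the derivative is \<open>cinner (R w (R w x)) y\<close>.\<close>

lemma holomorphic_resolvent: "(\<lambda>w. cinner (R w x) y) holomorphic_on (ball 0 r - {0})"
proof -
  have "((\<lambda>w. cinner (R w x) y) has_field_derivative cinner (R v (R v x)) y)
      (at v within ball 0 r - {0})" if v: "v \<noteq> 0" "cmod v < r" for v
    unfolding has_field_derivative_iff
  proof (rule Lim_transform_eventually)
    have "(R \<longlongrightarrow> R v) (at v within ball 0 r - {0})"
      using continuous_on_resolvent v by (simp add: continuous_on_def)
    then show "((\<lambda>w. cinner (R w (R v x)) y) \<longlongrightarrow> cinner (R v (R v x)) y)
        (at v within ball 0 r - {0})"
      by (intro bounded_linear.tendsto[OF bounded_linear_cinner_left] tendsto_intros)
    have "\<forall>\<^sub>F w in at v within ball 0 r - {0}. w \<noteq> v \<and> w \<in> ball 0 r - {0}"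
      by (simp add: eventually_at_filter)
    then show "\<forall>\<^sub>F w in at v within ball 0 r - {0}.
        cinner (R w (R v x)) y = (cinner (R w x) y - cinner (R v x) y) / (w - v)"
    proof eventually_elim
      case (elim w)
      have "cinner (R w x) y - cinner (R v x) y = (w - v) * cinner (R w (R v x)) y"
        using resolvent_identity[of w v x] elim v
        by (simp add: cinner_diff_left[symmetric] cinner_scaleC_left)
      then show ?case using elim by simp
    qed
  qed
  then show ?thesis
    unfolding holomorphic_on_def field_differentiable_def by (metis DiffE mem_ball_0 singletonI)
qed

text \<open>
  These are the coefficients of \<open>w\<^sup>-\<^sup>n\<close> in the Laurent expansion of \<open>w \<mapsto> R w x\<close> at 0.  The moment
  of order one is, up to sign, the Riesz projection for the isolated point 0.
\<close>

definition moment :: "real \<Rightarrow> nat \<Rightarrow> 'a \<Rightarrow> 'a"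
  where "moment \<epsilon> n x =
    integral {0..1} (\<lambda>t. (circlepath 0 \<epsilon> t) ^ n *\<^sub>C R (circlepath 0 \<epsilon> t) x)"

context
  fixes \<epsilon> :: real assumes \<epsilon>: "0 < \<epsilon>" "\<epsilon> < r"
begin

lemma circlepath_in_punctured_disc: "circlepath 0 \<epsilon> t \<noteq> 0" "cmod (circlepath 0 \<epsilon> t) < r"
  using norm_circlepath_0[of \<epsilon> t] \<epsilon> by auto

lemma continuous_on_resolvent_circlepath: "continuous_on {0..1} (\<lambda>t. R (circlepath 0 \<epsilon> t))"
  by (rule continuous_on_compose2[OF continuous_on_resolvent continuous_on_circlepath])
    (use circlepath_in_punctured_disc in auto)

lemma integrable_moment:
  "(\<lambda>t. (circlepath 0 \<epsilon> t) ^ n *\<^sub>C R (circlepath 0 \<epsilon> t) x) integrable_on {0..1}"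
  by (intro integrable_continuous_real continuous_on_scaleC continuous_on_power
      continuous_on_circlepath bounded_bilinear.continuous_on[OF bounded_bilinear_blinfun_apply]
      continuous_on_resolvent_circlepath continuous_on_const)

text \<open>
  Average \<open>w ^ n S (R w x) = w ^ n x + w ^ (n + 1) R w x\<close> over the circle; the average of \<open>w ^ n\<close>
  vanishes unless \<open>n = 0\<close>.
\<close>

lemma S_moment:
  "S (moment \<epsilon> n x) = (if n = 0 then x else 0) + moment \<epsilon> (Suc n) x"
proof -
  let ?c = "circlepath 0 \<epsilon>"
  have "S (moment \<epsilon> n x) = integral {0..1} (\<lambda>t. S (?c t ^ n *\<^sub>C R (?c t) x))"
    unfolding moment_def
    using integral_linear[OF integrable_moment S.bounded_linear] by (simp add: o_def)
  also have "\<dots> = integral {0..1} (\<lambda>t. ?c t ^ n *\<^sub>C x + ?c t ^ Suc n *\<^sub>C R (?c t) x)"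
    using circlepath_in_punctured_disc
    by (simp add: S_scaleC S_R scaleC_add_right scaleC_scaleC mult.commute)
  also have "\<dots> = integral {0..1} (\<lambda>t. ?c t ^ n *\<^sub>C x) + moment \<epsilon> (Suc n) x"
    unfolding moment_def
    by (intro integral_add integrable_moment integrable_continuous_real continuous_on_scaleC
        continuous_on_power continuous_on_circlepath continuous_on_const)
  also have "integral {0..1} (\<lambda>t. ?c t ^ n *\<^sub>C x) = integral {0..1} (\<lambda>t. ?c t ^ n) *\<^sub>C x"
    using integral_linear[of "\<lambda>t. ?c t ^ n" "{0..1}", OF _ bounded_linear_scaleC_left[of x]]
    by (simp add: o_def integrable_continuous_real continuous_on_power continuous_on_circlepath)
  also have "integral {0..1} (\<lambda>t. ?c t ^ n) = (if n = 0 then 1 else 0)"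
    using \<epsilon> by (simp add: integral_circlepath_0_power)
  finally show ?thesis
    by (simp add: scaleC_one scaleC_zero_left)
qed

lemma moment_S: "moment \<epsilon> n (S x) = S (moment \<epsilon> n x)"
proof -
  have "S (moment \<epsilon> n x)
      = integral {0..1} (\<lambda>t. S (circlepath 0 \<epsilon> t ^ n *\<^sub>C R (circlepath 0 \<epsilon> t) x))"
    unfolding moment_def
    using integral_linear[OF integrable_moment S.bounded_linear] by (simp add: o_def)
  also have "\<dots> = moment \<epsilon> n (S x)"
    unfolding moment_def using circlepath_in_punctured_disc by (simp add: S_scaleC S_R R_S)
  finally show ?thesis ..
qed

text \<open>
  The constant comes from a bound for \<open>norm (R w)\<close> on the compact circle, so it serves all orders.
\<close>

lemma moment_bound: "\<exists>K. \<forall>n. norm (moment \<epsilon> n x) \<le> K * \<epsilon> ^ n"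
proof -
  have "bounded ((\<lambda>t. R (circlepath 0 \<epsilon> t)) ` {0..1})"
    by (intro compact_imp_bounded compact_continuous_image continuous_on_resolvent_circlepath) simp
  then obtain M where M: "\<And>t. t \<in> {0..1} \<Longrightarrow> norm (R (circlepath 0 \<epsilon> t)) \<le> M"
    unfolding bounded_iff by blast
  have "norm (moment \<epsilon> n x) \<le> (M * norm x) * \<epsilon> ^ n" for n
  proof -
    have "norm (moment \<epsilon> n x) \<le> \<epsilon> ^ n * (M * norm x) * (1 - 0)"
      unfolding moment_def
    proof (rule integral_bound)
      fix t :: real assume t: "t \<in> {0..1}"
      have "norm (R (circlepath 0 \<epsilon> t) x) \<le> M * norm x"
        using norm_blinfun[of "R (circlepath 0 \<epsilon> t)" x] mult_right_mono[OF M[OF t], of "norm x"]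
        by simp
      then show "norm (circlepath 0 \<epsilon> t ^ n *\<^sub>C R (circlepath 0 \<epsilon> t) x) \<le> \<epsilon> ^ n * (M * norm x)"
        using \<epsilon> by (simp add: norm_scaleC norm_power norm_circlepath_0 mult_left_mono)
    qed (simp, intro continuous_on_scaleC continuous_on_power
      continuous_on_circlepath bounded_bilinear.continuous_on[OF bounded_bilinear_blinfun_apply]
      continuous_on_resolvent_circlepath continuous_on_const)
    then show ?thesis by (simp add: mult_ac)
  qed
  then show ?thesis by blast
qed

text \<open>
  The average of \<open>R w\<close> also exists as an integral of operators, and is therefore a bounded operator.
\<close>

lemma continuous_on_moment_0: "continuous_on UNIV (moment \<epsilon> 0)"
proof -
  have "moment \<epsilon> 0 = blinfun_apply (integral {0..1} (\<lambda>t. R (circlepath 0 \<epsilon> t)))"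
    unfolding moment_def using continuous_on_resolvent_circlepath
    by (simp add: fun_eq_iff scaleC_one blinfun_apply_integral integrable_continuous_real)
  then show ?thesis
    by (simp add: linear_continuous_on blinfun.bounded_linear_right)
qed

lemma cinner_moment_1:
  "2 * of_real pi * \<i> * cinner (moment \<epsilon> 1 x) y
    = contour_integral (circlepath 0 \<epsilon>) (\<lambda>w. cinner (R w x) y)"
  unfolding moment_def contour_integral_circlepath_0
  using integral_linear[OF integrable_moment[of 1 x] bounded_linear_cinner_left[of y]]
  by (simp add: o_def cinner_scaleC_left)

end

text \<open>
  Testing against \<open>y\<close> reduces this to deforming the circle in the punctured disc, where the
  scalar function \<open>w \<mapsto> cinner (R w x) y\<close> is holomorphic.
\<close>

lemma moment_1_radius_independent:
  assumes "0 < \<epsilon>" "\<epsilon> \<le> \<delta>" "\<delta> < r"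
  shows "moment \<epsilon> 1 x = moment \<delta> 1 x"
proof -
  have "cinner (moment \<epsilon> 1 x) y = cinner (moment \<delta> 1 x) y" for y
  proof -
    have "contour_integral (circlepath 0 \<delta>) (\<lambda>w. cinner (R w x) y)
        = contour_integral (circlepath 0 \<epsilon>) (\<lambda>w. cinner (R w x) y)"
      by (rule contour_integral_circlepath_eq(3)[OF open_ball holomorphic_resolvent])
        (use assms in auto)
    then have "2 * of_real pi * \<i> * cinner (moment \<epsilon> 1 x) y
        = 2 * of_real pi * \<i> * cinner (moment \<delta> 1 x) y"
      using assms by (simp only: cinner_moment_1 order.strict_trans1 order.strict_trans2)
    then show ?thesis by simp
  qed
  then have "cinner (moment \<epsilon> 1 x - moment \<delta> 1 x) (moment \<epsilon> 1 x - moment \<delta> 1 x) = 0"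
    by (simp add: cinner_diff_left)
  then show ?thesis
    by (simp add: cinner_eq_zero_iff)
qed

text \<open>
  Applying \<open>S\<close> to the moment of order one raises the order.  As that moment can be
  computed on arbitrarily small circles, its orbit under \<open>S\<close> decays faster than
  any geometric sequence, which paranormality forbids unless \<open>S\<close> annihilates it.
\<close>

lemma S_moment_1_eq_0:
  assumes para: "\<And>u. (norm (S u))\<^sup>2 \<le> norm (S (S u)) * norm u"
    and \<delta>: "0 < \<delta>" "\<delta> < r"
  shows "S (moment \<delta> 1 x) = 0"
proof (rule paranormal_orbit_eq_0[OF para S.zero \<delta>(1)])
  fix \<epsilon> :: real assume \<epsilon>: "0 < \<epsilon>" "\<epsilon> < \<delta>"
  then have "\<epsilon> < r" using \<delta> by simp
  have orbit: "(S ^^ n) (moment \<delta> 1 x) = moment \<epsilon> (Suc n) x" for n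
  proof (induction n)
    case 0
    then show ?case using moment_1_radius_independent[of \<epsilon> \<delta> x] \<epsilon> \<delta> by simp
  next
    case (Suc n)
    then show ?case using S_moment[OF \<epsilon>(1) \<open>\<epsilon> < r\<close>, of "Suc n" x] by simp
  qed
  obtain K where "\<And>n. norm (moment \<epsilon> n x) \<le> K * \<epsilon> ^ n"
    using moment_bound[OF \<epsilon>(1) \<open>\<epsilon> < r\<close>] by blast
  then have "norm ((S ^^ n) (moment \<delta> 1 x)) \<le> (K * \<epsilon>) * \<epsilon> ^ n" for n
    using orbit[of n] by (metis mult.assoc power_Suc)
  then show "\<exists>K. \<forall>n. norm ((S ^^ n) (moment \<delta> 1 x)) \<le> K * \<epsilon> ^ n" by blast
qed

text \<open>
  The moment \<open>B\<close> of order zero is a generalized inverse of \<open>S\<close>: with \<open>Q\<close> the moment of order one,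
  \<open>S B = 1 + Q\<close> and \<open>S Q = Q S = 0\<close> give \<open>S B S = S\<close>, so the range of \<open>S\<close> is the fixed point set of \<open>S B\<close>.
\<close>

lemma closed_range_S:
  assumes para: "\<And>u. (norm (S u))\<^sup>2 \<le> norm (S (S u)) * norm u"
  shows "closed (range S)"
proof -
  define \<delta> where "\<delta> = r / 2"
  have \<delta>: "0 < \<delta>" "\<delta> < r" using r_pos by (auto simp: \<delta>_def)
  have "S (moment \<delta> 0 (S x)) = S x" for x
    using S_moment[OF \<delta>, of 0 "S x"] S_moment_1_eq_0[OF para \<delta>, of x] moment_S[OF \<delta>, of 1 x]
    by simp
  then have "range S = {y. S (moment \<delta> 0 y) = y}"
    by (auto intro: range_eqI[OF sym])
  moreover have "continuous_on UNIV (\<lambda>y. S (moment \<delta> 0 y))"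
    by (intro S.continuous_on continuous_on_moment_0[OF \<delta>])
  ultimately show ?thesis
    by (simp add: closed_Collect_eq continuous_on_id)
qed

end

section \<open>Closed range\<close>

theorem corollary3p3:
  fixes T :: "'a::chilbert_space \<Rightarrow> 'a" and \<mu> :: complex
  assumes "hyponormal T"
    and "\<not> \<mu> islimpt spectrum T"
  shows "closed (range (\<lambda>x. T x - \<mu> *\<^sub>C x))"
proof -
  define S where "S x = T x - \<mu> *\<^sub>C x" for x
  have T: "bounded_clinear T"
    using assms(1) by (simp add: hyponormal_def)
  have S: "bounded_clinear S"
    unfolding bounded_clinear_def S_def
    using bounded_linear_sub[OF bounded_clinearD(1)[OF T] bounded_linear_scaleC_right[of \<mu>]]
    by (simp add: bounded_clinearD(2)[OF T] scaleC_diff_right scaleC_scaleC mult.commute)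
  obtain r where r: "r > 0" "\<And>w. w \<noteq> \<mu> \<Longrightarrow> dist w \<mu> < r \<Longrightarrow> w \<notin> spectrum T"
    using assms(2) by (auto simp: islimpt_approachable)
  \<comment> \<open>the inverse of \<open>S - w\<close> is that of \<open>T - (\<mu> + w)\<close>\<close>
  have "\<exists>A. bounded_clinear A \<and> (\<forall>x. S (A x) - w *\<^sub>C A x = x) \<and> (\<forall>x. A (S x - w *\<^sub>C x) = x)"
    if "w \<noteq> 0" "cmod w < r" for w
  proof -
    have "\<mu> + w \<notin> spectrum T"
      using that r(2)[of "\<mu> + w"] by (simp add: dist_norm)
    then obtain A where "bounded_clinear A" "(\<lambda>x. T x - (\<mu> + w) *\<^sub>C x) \<circ> A = id"
      "A \<circ> (\<lambda>x. T x - (\<mu> + w) *\<^sub>C x) = id"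
      by (auto simp: spectrum_def invertible_operator_def)
    then show ?thesis
      by (intro exI[of _ A]) (auto simp: S_def fun_eq_iff scaleC_add_left diff_diff_eq)
  qed
  then obtain A where A: "\<And>w. w \<noteq> 0 \<Longrightarrow> cmod w < r \<Longrightarrow> bounded_clinear (A w)"
    "\<And>w x. w \<noteq> 0 \<Longrightarrow> cmod w < r \<Longrightarrow> S (A w x) - w *\<^sub>C A w x = x"
    "\<And>w x. w \<noteq> 0 \<Longrightarrow> cmod w < r \<Longrightarrow> A w (S x - w *\<^sub>C x) = x"
    by metis
  interpret punctured_resolvent S "\<lambda>w. Blinfun (A w)" r
  proof
    fix w :: complex and a :: complex and x :: 'a
    assume w: "w \<noteq> 0" "cmod w < r"
    have [simp]: "blinfun_apply (Blinfun (A w)) = A w"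
      using A(1)[OF w] by (intro bounded_linear_Blinfun_apply) (rule bounded_clinearD)
    show "blinfun_apply (Blinfun (A w)) (a *\<^sub>C x) = a *\<^sub>C blinfun_apply (Blinfun (A w)) x"
      using bounded_clinearD(2)[OF A(1)[OF w]] by simp
    show "S (blinfun_apply (Blinfun (A w)) x) = x + w *\<^sub>C blinfun_apply (Blinfun (A w)) x"
      using A(2)[OF w, of x] by (simp add: algebra_simps)
    have "A w (S x) - w *\<^sub>C A w x = x"
      using A(3)[OF w, of x] bounded_clinearD[OF A(1)[OF w]]
      by (simp add: linear_simps)
    then show "blinfun_apply (Blinfun (A w)) (S x) = x + w *\<^sub>C blinfun_apply (Blinfun (A w)) x"
      by (simp add: algebra_simps)
  qed (fact S r(1))+
  have "closed (range S)"
    using hyponormal_translate_paranormal[OF assms(1), where \<mu> = \<mu>]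
    by (intro closed_range_S) (simp add: S_def)
  then show ?thesis
    by (simp add: S_def[abs_def])
qed

end
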